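(* There exists a stable Banach algebra which has no approximate identity.
   Context: A Banach algebra is a complete normed algebra, i.e. an associative complex algebra with a complete norm satisfying $\|ab\|\le\|a\|\,\|b\|$ (not necessarily unital). A normed algebra $A$ is left (resp. right) stable if for every $a\in A$ and every real $M>0$: whenever $\|ab\|\le M\|b\|$ (resp. $\|ba\|\le M\|b\|$) for all $b\in A$, then $\|a\|\le M$. $A$ is stable if it is both left and right stable. An approximate identity (two-sided) of $A$ is a net $(e_\lambda)_{\lambda\in\Lambda}$ in $A$, not assumed bounded, with $\lim_\lambda e_\lambda x=x=\lim_\lambda x e_\lambda$ for all $x\in A$. *)

theory Defs
  imports "HOL-Analysis.Analysis" "HOL-Algebra.Module"
begin

definition complex_ring :: "complex ring" where
  "complex_ring = \<lparr>carrier = UNIV, mult = (*), one = 1, zero = 0, add = (+)\<rparr>"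

text \<open>
  Algebras are not required to be unital: the field \<open>one\<close>, inherited from the record types of
  HOL-Algebra, is never constrained or used. For the same reason the locales \<open>ring\<close> and
  \<open>algebra\<close> of HOL-Algebra (unital, and commutative in the latter case) are not used.
\<close>

record 'a normed_algebra = "(complex, 'a) module" +
  nrm :: "'a \<Rightarrow> real" (\<open>\<parallel>_\<parallel>\<index>\<close>)

locale normed_algebra = Module.module complex_ring A for A :: "'a normed_algebra" (structure) +
  assumes mult_closed: "\<lbrakk>x \<in> carrier A; y \<in> carrier A\<rbrakk> \<Longrightarrow> x \<otimes> y \<in> carrier A"
    and mult_assoc:
      "\<lbrakk>x \<in> carrier A; y \<in> carrier A; z \<in> carrier A\<rbrakk> \<Longrightarrow> (x \<otimes> y) \<otimes> z = x \<otimes> (y \<otimes> z)"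
    and mult_add_left:
      "\<lbrakk>x \<in> carrier A; y \<in> carrier A; z \<in> carrier A\<rbrakk> \<Longrightarrow> (x \<oplus> y) \<otimes> z = x \<otimes> z \<oplus> y \<otimes> z"
    and mult_add_right:
      "\<lbrakk>x \<in> carrier A; y \<in> carrier A; z \<in> carrier A\<rbrakk> \<Longrightarrow> x \<otimes> (y \<oplus> z) = x \<otimes> y \<oplus> x \<otimes> z"
    and mult_smult_left:
      "\<lbrakk>x \<in> carrier A; y \<in> carrier A\<rbrakk> \<Longrightarrow> (c \<odot>\<^bsub>A\<^esub> x) \<otimes> y = c \<odot>\<^bsub>A\<^esub> (x \<otimes> y)"
    and mult_smult_right:
      "\<lbrakk>x \<in> carrier A; y \<in> carrier A\<rbrakk> \<Longrightarrow> x \<otimes> (c \<odot>\<^bsub>A\<^esub> y) = c \<odot>\<^bsub>A\<^esub> (x \<otimes> y)"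
    and nrm_nonneg: "x \<in> carrier A \<Longrightarrow> 0 \<le> \<parallel>x\<parallel>"
    and nrm_eq_zero_iff: "x \<in> carrier A \<Longrightarrow> \<parallel>x\<parallel> = 0 \<longleftrightarrow> x = \<zero>"
    and nrm_triangle: "\<lbrakk>x \<in> carrier A; y \<in> carrier A\<rbrakk> \<Longrightarrow> \<parallel>x \<oplus> y\<parallel> \<le> \<parallel>x\<parallel> + \<parallel>y\<parallel>"
    and nrm_smult: "x \<in> carrier A \<Longrightarrow> \<parallel>c \<odot>\<^bsub>A\<^esub> x\<parallel> = cmod c * \<parallel>x\<parallel>"
    and nrm_mult: "\<lbrakk>x \<in> carrier A; y \<in> carrier A\<rbrakk> \<Longrightarrow> \<parallel>x \<otimes> y\<parallel> \<le> \<parallel>x\<parallel> * \<parallel>y\<parallel>"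

text \<open>
  The locale \<open>Metric_space\<close> wants symmetry of the distance also outside the carrier, where the
  operations of the algebra are arbitrary; hence the case distinction.
\<close>

definition nrm_dist :: "'a normed_algebra \<Rightarrow> 'a \<Rightarrow> 'a \<Rightarrow> real" where
  "nrm_dist A x y = (if x \<in> carrier A \<and> y \<in> carrier A then \<parallel>x \<ominus>\<^bsub>A\<^esub> y\<parallel>\<^bsub>A\<^esub> else 0)"

lemma (in normed_algebra) Metric_space_nrm_dist: "Metric_space (carrier A) (nrm_dist A)"
proof
  have nrm_uminus: "\<parallel>\<ominus> x\<parallel> = \<parallel>x\<parallel>" if "x \<in> carrier A" for x
  proof -
    have "(- 1) \<odot>\<^bsub>A\<^esub> x \<oplus> x = (- 1) \<odot>\<^bsub>A\<^esub> x \<oplus> 1 \<odot>\<^bsub>A\<^esub> x"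
      using smult_one that by (simp add: complex_ring_def)
    also have "\<dots> = 0 \<odot>\<^bsub>A\<^esub> x"
      using smult_l_distr[of "- 1" 1 x] that by (simp add: complex_ring_def)
    also have "\<dots> = \<zero>"
      using nrm_smult[of x 0] nrm_eq_zero_iff smult_closed[of 0 x] that
      by (simp add: complex_ring_def)
    finally have "\<ominus> x = (- 1) \<odot>\<^bsub>A\<^esub> x"
      using that smult_closed[of "- 1" x] by (intro minus_equality) (auto simp: complex_ring_def)
    then show ?thesis using nrm_smult[OF that, of "- 1"] by simp
  qed
  show "0 \<le> nrm_dist A x y" for x y
    by (simp add: nrm_dist_def nrm_nonneg)
  have swap: "\<ominus> (x \<ominus> y) = y \<ominus> x" if "x \<in> carrier A" "y \<in> carrier A" for x y
    using that by (simp add: a_minus_def minus_add a_comm)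
  show "nrm_dist A x y = nrm_dist A y x" for x y
    using nrm_uminus[of "x \<ominus> y"] swap[of x y] by (auto simp: nrm_dist_def)
  show "nrm_dist A x y = 0 \<longleftrightarrow> x = y" if "x \<in> carrier A" "y \<in> carrier A" for x y
  proof -
    have "x = y" if "x \<ominus> y = \<zero>"
      using that \<open>x \<in> carrier A\<close> \<open>y \<in> carrier A\<close>
      by (metis a_minus_def a_inv_closed minus_equality minus_minus)
    moreover have "y \<ominus> y = \<zero>"
      using that by (simp add: a_minus_def r_neg)
    ultimately show ?thesis
      using that by (auto simp: nrm_dist_def nrm_eq_zero_iff)
  qed
  show "nrm_dist A x z \<le> nrm_dist A x y + nrm_dist A y z"
    if "x \<in> carrier A" "y \<in> carrier A" "z \<in> carrier A" for x y z
  proof -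
    have "x \<ominus> z = (x \<ominus> y) \<oplus> (y \<ominus> z)"
      using that by (simp add: a_minus_def a_assoc r_neg2 r_neg1)
    then show ?thesis
      using that nrm_triangle[of "x \<ominus> y" "y \<ominus> z"] by (simp add: nrm_dist_def)
  qed
qed

locale banach_algebra = normed_algebra +
  assumes complete: "Metric_space.mcomplete (carrier A) (nrm_dist A)"

definition left_stable :: "'a normed_algebra \<Rightarrow> bool" where
  "left_stable A \<longleftrightarrow> (\<forall>a\<in>carrier A. \<forall>M>0.
     (\<forall>b\<in>carrier A. \<parallel>a \<otimes>\<^bsub>A\<^esub> b\<parallel>\<^bsub>A\<^esub> \<le> M * \<parallel>b\<parallel>\<^bsub>A\<^esub>) \<longrightarrow> \<parallel>a\<parallel>\<^bsub>A\<^esub> \<le> M)"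

definition right_stable :: "'a normed_algebra \<Rightarrow> bool" where
  "right_stable A \<longleftrightarrow> (\<forall>a\<in>carrier A. \<forall>M>0.
     (\<forall>b\<in>carrier A. \<parallel>b \<otimes>\<^bsub>A\<^esub> a\<parallel>\<^bsub>A\<^esub> \<le> M * \<parallel>b\<parallel>\<^bsub>A\<^esub>) \<longrightarrow> \<parallel>a\<parallel>\<^bsub>A\<^esub> \<le> M)"

definition stable :: "'a normed_algebra \<Rightarrow> bool" where
  "stable A \<longleftrightarrow> left_stable A \<and> right_stable A"

definition directed_set :: "'i set \<Rightarrow> 'i rel \<Rightarrow> bool" where
  "directed_set \<Lambda> r \<longleftrightarrow> \<Lambda> \<noteq> {} \<and> preorder_on \<Lambda> r \<and>
     (\<forall>i\<in>\<Lambda>. \<forall>j\<in>\<Lambda>. \<exists>k\<in>\<Lambda>. (i, k) \<in> r \<and> (j, k) \<in> r)"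

definition net_tendsto ::
    "'a normed_algebra \<Rightarrow> 'i set \<Rightarrow> 'i rel \<Rightarrow> ('i \<Rightarrow> 'a) \<Rightarrow> 'a \<Rightarrow> bool" where
  "net_tendsto A \<Lambda> r u x \<longleftrightarrow>
     (\<forall>\<epsilon>>0. \<exists>i\<in>\<Lambda>. \<forall>j\<in>\<Lambda>. (i, j) \<in> r \<longrightarrow> \<parallel>u j \<ominus>\<^bsub>A\<^esub> x\<parallel>\<^bsub>A\<^esub> < \<epsilon>)"

definition approximate_identity ::
    "'a normed_algebra \<Rightarrow> 'i set \<Rightarrow> 'i rel \<Rightarrow> ('i \<Rightarrow> 'a) \<Rightarrow> bool" where
  "approximate_identity A \<Lambda> r e \<longleftrightarrow>
     directed_set \<Lambda> r \<and> e \<in> \<Lambda> \<rightarrow> carrier A \<and>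
     (\<forall>x\<in>carrier A. net_tendsto A \<Lambda> r (\<lambda>i. e i \<otimes>\<^bsub>A\<^esub> x) x \<and>
                    net_tendsto A \<Lambda> r (\<lambda>i. x \<otimes>\<^bsub>A\<^esub> e i) x)"

text \<open>
  A formula cannot quantify over the type of the indices. Indices of type \<open>'a set \<times> nat\<close>
  suffice: an approximate identity with indices of any type yields one of this type,
  see \<open>has_approximate_identityI\<close> below.
\<close>

definition has_approximate_identity :: "'a normed_algebra \<Rightarrow> bool" where
  "has_approximate_identity A \<longleftrightarrow>
     (\<exists>(\<Lambda> :: ('a set \<times> nat) set) r e. approximate_identity A \<Lambda> r e)"

lemma directed_set_finite_upper_bound:
  assumes "directed_set \<Lambda> r" "finite I" "I \<subseteq> \<Lambda>"
  shows "\<exists>k\<in>\<Lambda>. \<forall>i\<in>I. (i, k) \<in> r"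
  using assms(2,3)
proof (induction I rule: finite_induct)
  case empty
  then show ?case using assms(1) by (auto simp: directed_set_def)
next
  case (insert i I)
  then obtain k where k: "k \<in> \<Lambda>" "\<forall>i\<in>I. (i, k) \<in> r" by auto
  then obtain l where l: "l \<in> \<Lambda>" "(i, l) \<in> r" "(k, l) \<in> r"
    using assms(1) insert.prems unfolding directed_set_def by blast
  moreover have "trans r"
    using assms(1) by (simp add: directed_set_def preorder_on_def)
  ultimately show ?case using k by (metis insert_iff transD)
qed

lemma has_approximate_identityI:
  fixes A :: "'a normed_algebra" and \<Lambda> :: "'i set"
  assumes ai: "approximate_identity A \<Lambda> r e"
  shows "has_approximate_identity A"
proof -
  define \<Lambda>' :: "('a set \<times> nat) set" where "\<Lambda>' = {F. finite F \<and> F \<subseteq> carrier A} \<times> UNIV"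
  define r' where "r' = {(p, q). p \<in> \<Lambda>' \<and> q \<in> \<Lambda>' \<and> fst p \<subseteq> fst q \<and> snd p \<le> snd q}"
  define good where "good = (\<lambda>p i. i \<in> \<Lambda> \<and> (\<forall>x\<in>fst p.
      \<parallel>e i \<otimes>\<^bsub>A\<^esub> x \<ominus>\<^bsub>A\<^esub> x\<parallel>\<^bsub>A\<^esub> < 1 / real (Suc (snd p)) \<and>
      \<parallel>x \<otimes>\<^bsub>A\<^esub> e i \<ominus>\<^bsub>A\<^esub> x\<parallel>\<^bsub>A\<^esub> < 1 / real (Suc (snd p))))"
  have dir: "directed_set \<Lambda> r" and e: "e \<in> \<Lambda> \<rightarrow> carrier A"
    using ai by (auto simp: approximate_identity_def)
  have good_ex: "\<exists>i. good p i" if "p \<in> \<Lambda>'" for p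
  proof -
    let ?\<epsilon> = "1 / real (Suc (snd p))"
    have fin: "finite (fst p)" and sub: "fst p \<subseteq> carrier A"
      using that by (auto simp: \<Lambda>'_def)
    have "\<forall>x\<in>fst p. \<exists>i\<in>\<Lambda>. \<forall>j\<in>\<Lambda>. (i, j) \<in> r \<longrightarrow> \<parallel>e j \<otimes>\<^bsub>A\<^esub> x \<ominus>\<^bsub>A\<^esub> x\<parallel>\<^bsub>A\<^esub> < ?\<epsilon>"
      using ai sub unfolding approximate_identity_def net_tendsto_def by auto
    then obtain f where f: "\<forall>x\<in>fst p. f x \<in> \<Lambda> \<and>
        (\<forall>j\<in>\<Lambda>. (f x, j) \<in> r \<longrightarrow> \<parallel>e j \<otimes>\<^bsub>A\<^esub> x \<ominus>\<^bsub>A\<^esub> x\<parallel>\<^bsub>A\<^esub> < ?\<epsilon>)" by metis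
    have "\<forall>x\<in>fst p. \<exists>i\<in>\<Lambda>. \<forall>j\<in>\<Lambda>. (i, j) \<in> r \<longrightarrow> \<parallel>x \<otimes>\<^bsub>A\<^esub> e j \<ominus>\<^bsub>A\<^esub> x\<parallel>\<^bsub>A\<^esub> < ?\<epsilon>"
      using ai sub unfolding approximate_identity_def net_tendsto_def by auto
    then obtain g where g: "\<forall>x\<in>fst p. g x \<in> \<Lambda> \<and>
        (\<forall>j\<in>\<Lambda>. (g x, j) \<in> r \<longrightarrow> \<parallel>x \<otimes>\<^bsub>A\<^esub> e j \<ominus>\<^bsub>A\<^esub> x\<parallel>\<^bsub>A\<^esub> < ?\<epsilon>)" by metis
    have "finite (f ` fst p \<union> g ` fst p)" "f ` fst p \<union> g ` fst p \<subseteq> \<Lambda>"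
      using fin f g by auto
    from directed_set_finite_upper_bound[OF dir this]
    obtain k where "k \<in> \<Lambda>" "\<forall>i \<in> f ` fst p \<union> g ` fst p. (i, k) \<in> r" by blast
    then have "good p k" using f g unfolding good_def by blast
    then show ?thesis ..
  qed
  define e' where "e' = (\<lambda>p. e (SOME i. good p i))"
  have good_some: "good p (SOME i. good p i)" if "p \<in> \<Lambda>'" for p
    using good_ex[OF that] by (rule someI_ex)
  have dir': "directed_set \<Lambda>' r'"
    unfolding directed_set_def
  proof (intro conjI ballI)
    show "\<Lambda>' \<noteq> {}" by (auto simp: \<Lambda>'_def)
    show "preorder_on \<Lambda>' r'"
      unfolding preorder_on_def refl_on_def trans_def r'_def by auto
    fix p q assume "p \<in> \<Lambda>'" "q \<in> \<Lambda>'"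
    then show "\<exists>k\<in>\<Lambda>'. (p, k) \<in> r' \<and> (q, k) \<in> r'"
      by (intro bexI[of _ "(fst p \<union> fst q, max (snd p) (snd q))"]) (auto simp: r'_def \<Lambda>'_def)
  qed
  have e': "e' \<in> \<Lambda>' \<rightarrow> carrier A"
    using good_some e unfolding e'_def good_def by blast
  have lim: "net_tendsto A \<Lambda>' r' (\<lambda>p. e' p \<otimes>\<^bsub>A\<^esub> x) x \<and> net_tendsto A \<Lambda>' r' (\<lambda>p. x \<otimes>\<^bsub>A\<^esub> e' p) x"
    if x: "x \<in> carrier A" for x
  proof -
    have "\<exists>p\<in>\<Lambda>'. \<forall>q\<in>\<Lambda>'. (p, q) \<in> r' \<longrightarrow>
        \<parallel>e' q \<otimes>\<^bsub>A\<^esub> x \<ominus>\<^bsub>A\<^esub> x\<parallel>\<^bsub>A\<^esub> < \<epsilon> \<and> \<parallel>x \<otimes>\<^bsub>A\<^esub> e' q \<ominus>\<^bsub>A\<^esub> x\<parallel>\<^bsub>A\<^esub> < \<epsilon>"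
      if pos: "\<epsilon> > 0" for \<epsilon> :: real
    proof -
      obtain n where n: "1 / real (Suc n) < \<epsilon>"
        using nat_approx_posE[OF pos] by metis
      show ?thesis
      proof (intro bexI[of _ "({x}, n)"] ballI impI)
        show "({x}, n) \<in> \<Lambda>'" using x by (auto simp: \<Lambda>'_def)
        fix q assume q: "q \<in> \<Lambda>'" and "(({x}, n), q) \<in> r'"
        then have "x \<in> fst q" "n \<le> snd q" by (auto simp: r'_def)
        moreover from this have "1 / real (Suc (snd q)) \<le> 1 / real (Suc n)"
          by (simp add: frac_le)
        ultimately show "\<parallel>e' q \<otimes>\<^bsub>A\<^esub> x \<ominus>\<^bsub>A\<^esub> x\<parallel>\<^bsub>A\<^esub> < \<epsilon> \<and> \<parallel>x \<otimes>\<^bsub>A\<^esub> e' q \<ominus>\<^bsub>A\<^esub> x\<parallel>\<^bsub>A\<^esub> < \<epsilon>"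
          using good_some[OF q] n unfolding good_def e'_def by fastforce
      qed
    qed
    then show ?thesis unfolding net_tendsto_def by meson
  qed
  show ?thesis
    unfolding has_approximate_identity_def approximate_identity_def
    using dir' e' lim by blast
qed

end

theory Submission
  imports Defs
begin

text \<open>
  A finite-dimensional example suffices. Take the algebra with basis \<open>e, \<epsilon>, v, w\<close> in which \<open>e\<close> is
  idempotent, \<open>e\<epsilon> = \<epsilon> = \<epsilon>e\<close>, \<open>ev = v\<close>, \<open>we = w\<close>, \<open>vw = \<epsilon>\<close>, and all other products of basis
  elements vanish, with the norm
  \<open>\<parallel>\<alpha>e + \<beta>\<epsilon> + \<gamma>v + \<delta>w\<parallel> = |\<alpha>| + max {|\<beta>|, |\<gamma>|, |\<delta>|}\<close>.
  No product \<open>uw\<close> has a \<open>w\<close>-component, so \<open>\<parallel>uw - w\<parallel> \<ge> 1\<close> for every \<open>u\<close> and there is no left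
  approximate identity. Left stability is witnessed by unit vectors: multiplying \<open>a\<close> on the right
  by \<open>e\<close> gives norm \<open>|\<alpha>| + max {|\<beta>|, |\<delta>|}\<close>, and multiplying by \<open>\<epsilon> + \<zeta>w\<close>, for a unimodular
  \<open>\<zeta>\<close> aligning the phases, gives \<open>|\<alpha> + \<zeta>\<gamma>| = |\<alpha>| + |\<gamma>|\<close>. Right stability is
  symmetric, with \<open>\<epsilon> + \<zeta>v\<close>.
\<close>

text \<open>Vectors of four coordinates are embedded in \<open>nat => complex\<close> by zero
  padding; the default value 0 puts every \<open>vec4\<close> in the carrier of
  \<open>alg4\<close>.\<close>

definition vec4 :: "complex \<Rightarrow> complex \<Rightarrow> complex \<Rightarrow> complex \<Rightarrow> nat \<Rightarrow> complex" where
  "vec4 a b c d = (\<lambda>_. 0)(0 := a, 1 := b, 2 := c, 3 := d)"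

text \<open>The coordinates \<open>0, 1, 2, 3\<close> belong to \<open>e, \<epsilon>, v, w\<close>; the field \<open>one\<close> is junk.\<close>

definition alg4 :: "(nat \<Rightarrow> complex) normed_algebra" where
  "alg4 = \<lparr>carrier = {x. \<forall>n\<ge>4. x n = 0},
    mult = (\<lambda>x y. vec4 (x 0 * y 0) (x 0 * y 1 + x 1 * y 0 + x 2 * y 3) (x 0 * y 2) (x 3 * y 0)),
    one = (\<lambda>_. 0), zero = (\<lambda>_. 0), add = (\<lambda>x y n. x n + y n), smult = (\<lambda>c x n. c * x n),
    nrm = (\<lambda>x. cmod (x 0) + max (cmod (x 1)) (max (cmod (x 2)) (cmod (x 3))))\<rparr>"

lemma vec4_simps [simp]:
  "vec4 a b c d 0 = a" "vec4 a b c d (Suc 0) = b" "vec4 a b c d 2 = c" "vec4 a b c d 3 = d"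
  "n \<ge> 4 \<Longrightarrow> vec4 a b c d n = 0"
  by (auto simp: vec4_def)

lemma alg4_simps [simp]:
  "x \<in> carrier alg4 \<longleftrightarrow> (\<forall>n\<ge>4. x n = 0)"
  "x \<otimes>\<^bsub>alg4\<^esub> y =
    vec4 (x 0 * y 0) (x 0 * y 1 + x 1 * y 0 + x 2 * y 3) (x 0 * y 2) (x 3 * y 0)"
  "\<zero>\<^bsub>alg4\<^esub> = (\<lambda>_. 0)"
  "x \<oplus>\<^bsub>alg4\<^esub> y = (\<lambda>n. x n + y n)"
  "c \<odot>\<^bsub>alg4\<^esub> x = (\<lambda>n. c * x n)"
  "\<parallel>x\<parallel>\<^bsub>alg4\<^esub> = cmod (x 0) + max (cmod (x 1)) (max (cmod (x 2)) (cmod (x 3)))"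
  by (simp_all add: alg4_def)

lemma eq_if_coordinates_eq:
  fixes x y :: "nat \<Rightarrow> complex"
  assumes "\<forall>n\<ge>4. x n = 0" "\<forall>n\<ge>4. y n = 0" "x 0 = y 0" "x 1 = y 1" "x 2 = y 2" "x 3 = y 3"
  shows "x = y"
proof
  fix n :: nat
  have "n = 0 \<or> n = 1 \<or> n = 2 \<or> n = 3 \<or> n \<ge> 4" by linarith
  then show "x n = y n" using assms by auto
qed

text \<open>This is submultiplicativity of the norm. With \<open>m\<close> and \<open>m'\<close> the
  two maxima, the right side expands into four products: \<open>norm a * norm a'\<close> bounds the
  first summand, and the sum of the other three bounds every entry of the maximum.\<close>

lemma add_max3_mult_le:
  fixes a :: "'a :: real_normed_algebra"
  shows "norm (a * a') + max (norm (a * b' + b * a' + c * d')) (max (norm (a * c')) (norm (d * a')))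
    \<le> (norm a + max (norm b) (max (norm c) (norm d)))
      * (norm a' + max (norm b') (max (norm c') (norm d')))"
proof -
  define m where "m = max (norm b) (max (norm c) (norm d))"
  define m' where "m' = max (norm b') (max (norm c') (norm d'))"
  have m: "norm b \<le> m" "norm c \<le> m" "norm d \<le> m" "0 \<le> m"
    and m': "norm b' \<le> m'" "norm c' \<le> m'" "norm d' \<le> m'" "0 \<le> m'"
    by (auto simp: m_def m'_def le_max_iff_disj)
  have le: "norm (x * y) \<le> s * t" if "norm x \<le> s" "norm y \<le> t" "0 \<le> s" for x y :: 'a and s t
    using norm_mult_ineq[of x y] mult_mono[OF that(1,2,3)] by (meson norm_ge_zero order_trans)
  have nn: "0 \<le> norm a * m'" "0 \<le> m * norm a'" "0 \<le> m * m'"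
    using m m' by simp_all
  have "norm (a * b' + b * a' + c * d') \<le> norm (a * b') + norm (b * a') + norm (c * d')"
    by (rule norm_triangle_le [OF add_right_mono [OF norm_triangle_ineq]])
  also have "\<dots> \<le> norm a * m' + m * norm a' + m * m'"
    using m m' by (intro add_mono le) auto
  finally have "norm (a * b' + b * a' + c * d') \<le> norm a * m' + m * norm a' + m * m'" .
  moreover have "norm (a * c') \<le> norm a * m'" "norm (d * a') \<le> m * norm a'"
    using m m' by (auto intro!: le)
  moreover have "norm (a * a') \<le> norm a * norm a'"
    by (rule norm_mult_ineq)
  ultimately have "norm (a * a')
      + max (norm (a * b' + b * a' + c * d')) (max (norm (a * c')) (norm (d * a')))
    \<le> norm a * norm a' + (norm a * m' + m * norm a' + m * m')"
    using nn by auto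
  then show ?thesis
    by (simp add: m_def [symmetric] m'_def [symmetric] algebra_simps)
qed

lemma cring_complex_ring: "cring complex_ring"
proof (intro cringI abelian_groupI comm_monoidI)
  show "\<exists>y\<in>carrier complex_ring. y \<oplus>\<^bsub>complex_ring\<^esub> x = \<zero>\<^bsub>complex_ring\<^esub>" for x
    by (auto simp: complex_ring_def intro: exI[of _ "- x"])
qed (auto simp: complex_ring_def algebra_simps)

lemma abelian_group_alg4: "abelian_group alg4"
proof (rule abelian_groupI)
  show "\<exists>y\<in>carrier alg4. y \<oplus>\<^bsub>alg4\<^esub> x = \<zero>\<^bsub>alg4\<^esub>" if "x \<in> carrier alg4" for x
    using that by (intro bexI[of _ "\<lambda>n. - x n"]) auto
qed (auto simp: add.assoc add.commute)

lemma alg4_minus [simp]: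
  assumes "x \<in> carrier alg4" "y \<in> carrier alg4"
  shows "x \<ominus>\<^bsub>alg4\<^esub> y = (\<lambda>n. x n - y n)"
proof -
  interpret abelian_group alg4 by (rule abelian_group_alg4)
  \<comment> \<open>The additive inverse is a definite description over the carrier; uniqueness of
    negatives evaluates it.\<close>
  have "\<ominus>\<^bsub>alg4\<^esub> y = (\<lambda>n. - y n)"
    using assms by (intro minus_equality) auto
  then show ?thesis by (simp add: a_minus_def)
qed

lemma normed_algebra_alg4: "normed_algebra alg4"
proof -
  have "Module.module complex_ring alg4"
    by (intro moduleI cring_complex_ring abelian_group_alg4)
      (auto simp: complex_ring_def algebra_simps)
  moreover have "normed_algebra_axioms alg4"
  proof
    fix x y :: "nat \<Rightarrow> complex"
    show "\<parallel>x\<parallel>\<^bsub>alg4\<^esub> = 0 \<longleftrightarrow> x = \<zero>\<^bsub>alg4\<^esub>" if "x \<in> carrier alg4"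
    proof
      assume 0: "\<parallel>x\<parallel>\<^bsub>alg4\<^esub> = 0"
      have "cmod (x 0) \<le> \<parallel>x\<parallel>\<^bsub>alg4\<^esub>" "cmod (x 1) \<le> \<parallel>x\<parallel>\<^bsub>alg4\<^esub>" "cmod (x 2) \<le> \<parallel>x\<parallel>\<^bsub>alg4\<^esub>"
        "cmod (x 3) \<le> \<parallel>x\<parallel>\<^bsub>alg4\<^esub>"
        by (simp_all add: le_max_iff_disj add_increasing)
      then show "x = \<zero>\<^bsub>alg4\<^esub>"
        unfolding 0 using that by (intro eq_if_coordinates_eq) auto
    qed simp
    show "\<parallel>x \<oplus>\<^bsub>alg4\<^esub> y\<parallel>\<^bsub>alg4\<^esub> \<le> \<parallel>x\<parallel>\<^bsub>alg4\<^esub> + \<parallel>y\<parallel>\<^bsub>alg4\<^esub>"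
      using norm_triangle_ineq[of "x 0" "y 0"] norm_triangle_ineq[of "x 1" "y 1"]
        norm_triangle_ineq[of "x 2" "y 2"] norm_triangle_ineq[of "x 3" "y 3"]
      by simp
    show "\<parallel>c \<odot>\<^bsub>alg4\<^esub> x\<parallel>\<^bsub>alg4\<^esub> = cmod c * \<parallel>x\<parallel>\<^bsub>alg4\<^esub>" for c
      by (simp add: norm_mult distrib_left max_mult_distrib_left)
    show "\<parallel>x \<otimes>\<^bsub>alg4\<^esub> y\<parallel>\<^bsub>alg4\<^esub> \<le> \<parallel>x\<parallel>\<^bsub>alg4\<^esub> * \<parallel>y\<parallel>\<^bsub>alg4\<^esub>"
      using add_max3_mult_le[of "x 0" "y 0" "y 1" "x 1" "x 2" "y 3" "y 2" "x 3"] by simp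
  qed (auto intro!: eq_if_coordinates_eq simp: algebra_simps le_max_iff_disj)
  ultimately show ?thesis by (rule normed_algebra.intro)
qed

lemma nrm_dist_alg4:
  assumes "x \<in> carrier alg4" "y \<in> carrier alg4"
  shows "nrm_dist alg4 x y = dist (x 0) (y 0)
    + max (dist (x 1) (y 1)) (max (dist (x 2) (y 2)) (dist (x 3) (y 3)))"
  using assms by (simp add: nrm_dist_def dist_norm)

text \<open>Each of the four coordinates is 1-Lipschitz, so a Cauchy sequence converges
  coordinatewise. The distance is continuous in the four coordinate distances, so the vector of
  limits is the limit in norm.\<close>

lemma banach_algebra_alg4: "banach_algebra alg4"
proof -
  interpret normed_algebra alg4 by (rule normed_algebra_alg4)
  interpret Metric_space "carrier alg4" "nrm_dist alg4" by (rule Metric_space_nrm_dist)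
  have "mcomplete"
    unfolding mcomplete_def
  proof (intro allI impI)
    fix s assume s: "MCauchy s"
    then have car: "s k \<in> carrier alg4" for k
      by (auto simp: MCauchy_def simp del: alg4_simps)
    have conv: "\<exists>l. (\<lambda>k. s k i) \<longlonglongrightarrow> l" if "i \<in> {0, 1, 2, 3}" for i
    proof -
      have le: "dist (s k i) (s l i) \<le> nrm_dist alg4 (s k) (s l)" for k l
        unfolding nrm_dist_alg4[OF car car] using that by (auto simp: le_max_iff_disj add_increasing)
      have "Cauchy (\<lambda>k. s k i)"
        using s le unfolding MCauchy_def Cauchy_def by (meson order_le_less_trans)
      then show ?thesis
        by (simp add: Cauchy_convergent_iff convergent_def)
    qed
    obtain a b c d where lim: "(\<lambda>k. s k 0) \<longlonglongrightarrow> a" "(\<lambda>k. s k 1) \<longlonglongrightarrow> b"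
      "(\<lambda>k. s k 2) \<longlonglongrightarrow> c" "(\<lambda>k. s k 3) \<longlonglongrightarrow> d"
      using conv[of 0] conv[of 1] conv[of 2] conv[of 3] by auto
    have car': "vec4 a b c d \<in> carrier alg4" by simp
    have "(\<lambda>k. dist (s k 0) a + max (dist (s k 1) b) (max (dist (s k 2) c) (dist (s k 3) d)))
      \<longlonglongrightarrow> 0 + max 0 (max 0 0)"
      using lim by (intro tendsto_add tendsto_max) (simp_all add: tendsto_dist_iff [symmetric])
    then have "(\<lambda>k. nrm_dist alg4 (s k) (vec4 a b c d)) \<longlonglongrightarrow> 0"
      by (simp add: nrm_dist_alg4[OF car car'])
    then show "\<exists>x. limitin mtopology s x sequentially"
      using car car' by (auto simp: limitin_metric_dist_null simp del: alg4_simps)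
  qed
  then show ?thesis
    by (simp add: banach_algebra_def banach_algebra_axioms_def normed_algebra_alg4)
qed

text \<open>Rotating \<open>c\<close> by the difference of the arguments puts it on the ray of
  \<open>a\<close>, where moduli add. The polar form holds at 0 too, so no case split
  arises.\<close>

lemma exists_norm_add_rotation_eq:
  fixes a c :: complex
  obtains z where "cmod z = 1" "cmod (a + z * c) = cmod a + cmod c"
proof
  let ?z = "cis (Arg a - Arg c)"
  show "cmod ?z = 1" by simp
  have "?z * c = ?z * (of_real (cmod c) * cis (Arg c))"
    using rcis_cmod_Arg[of c] by (simp add: rcis_def)
  also have "\<dots> = of_real (cmod c) * cis (Arg a)"
    by (simp add: cis_mult)
  finally have "a + ?z * c = of_real (cmod a + cmod c) * cis (Arg a)"
    using rcis_cmod_Arg[of a] by (simp add: rcis_def distrib_right)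
  then show "cmod (a + ?z * c) = cmod a + cmod c"
    by (simp add: norm_mult del: of_real_add)
qed

lemma stable_alg4: "stable alg4"
proof -
  have "\<parallel>x\<parallel>\<^bsub>alg4\<^esub> \<le> M" if le: "\<forall>y\<in>carrier alg4. \<parallel>x \<otimes>\<^bsub>alg4\<^esub> y\<parallel>\<^bsub>alg4\<^esub> \<le> M * \<parallel>y\<parallel>\<^bsub>alg4\<^esub>" for x M
  proof -
    obtain z where "cmod z = 1" "cmod (x 0 + z * x 2) = cmod (x 0) + cmod (x 2)"
      by (rule exists_norm_add_rotation_eq)
    \<comment> \<open>The maximum in the norm gives \<open>vec4 0 1 0 z\<close> norm 1, and the only
      nonzero coordinate its product with \<open>x\<close> can have is the second,
      \<open>x 0 + z * x 2\<close>.\<close>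
    then have "cmod (x 0) + cmod (x 2) \<le> M"
      using le[rule_format, of "vec4 0 1 0 z"] by (simp add: mult.commute)
    \<comment> \<open>Right multiplication by the idempotent erases only the coordinate
      \<open>x 2\<close>, which the previous bound controls. The norm of \<open>x\<close> is the
      larger of the two bounded quantities.\<close>
    moreover have "cmod (x 0) + max (cmod (x 1)) (cmod (x 3)) \<le> M"
      using le[rule_format, of "vec4 1 0 0 0"] by (simp add: max_absorb1 max_absorb2)
    ultimately show ?thesis
      by simp
  qed
  moreover have "\<parallel>x\<parallel>\<^bsub>alg4\<^esub> \<le> M"
    if le: "\<forall>y\<in>carrier alg4. \<parallel>y \<otimes>\<^bsub>alg4\<^esub> x\<parallel>\<^bsub>alg4\<^esub> \<le> M * \<parallel>y\<parallel>\<^bsub>alg4\<^esub>" for x M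
  proof -
    obtain z where "cmod z = 1" "cmod (x 0 + z * x 3) = cmod (x 0) + cmod (x 3)"
      by (rule exists_norm_add_rotation_eq)
    then have "cmod (x 0) + cmod (x 3) \<le> M"
      using le[rule_format, of "vec4 0 1 z 0"] by (simp add: mult.commute)
    \<comment> \<open>On the left the idempotent erases \<open>x 3\<close> instead.\<close>
    moreover have "cmod (x 0) + max (cmod (x 1)) (cmod (x 2)) \<le> M"
      using le[rule_format, of "vec4 1 0 0 0"] by (simp add: max_absorb1 max_absorb2)
    ultimately show ?thesis
      by simp
  qed
  ultimately show ?thesis
    unfolding stable_def left_stable_def right_stable_def by blast
qed

lemma no_approximate_identity_alg4: "\<not> has_approximate_identity alg4"
proof
  let ?w = "vec4 0 0 0 1"
  assume "has_approximate_identity alg4"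
  then obtain \<Lambda> :: "((nat \<Rightarrow> complex) set \<times> nat) set" and r e
    where ai: "approximate_identity alg4 \<Lambda> r e"
    by (auto simp: has_approximate_identity_def)
  moreover have "?w \<in> carrier alg4"
    by simp
  ultimately have "net_tendsto alg4 \<Lambda> r (\<lambda>i. e i \<otimes>\<^bsub>alg4\<^esub> ?w) ?w"
    unfolding approximate_identity_def by blast
  then obtain i where i: "i \<in> \<Lambda>"
    and "\<forall>j\<in>\<Lambda>. (i, j) \<in> r \<longrightarrow> \<parallel>e j \<otimes>\<^bsub>alg4\<^esub> ?w \<ominus>\<^bsub>alg4\<^esub> ?w\<parallel>\<^bsub>alg4\<^esub> < 1"
    unfolding net_tendsto_def using zero_less_one by blast
  \<comment> \<open>By reflexivity the index \<open>i\<close> itself already gives the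
    contradiction.\<close>
  moreover have "(i, i) \<in> r"
    using ai i by (simp add: approximate_identity_def directed_set_def preorder_on_def refl_on_def)
  ultimately have "\<parallel>e i \<otimes>\<^bsub>alg4\<^esub> ?w \<ominus>\<^bsub>alg4\<^esub> ?w\<parallel>\<^bsub>alg4\<^esub> < 1"
    by blast
  \<comment> \<open>The last coordinate of the difference is -1 whatever \<open>e i\<close> is,
    which contradicts the tolerance 1.\<close>
  then show False by simp
qed

theorem theorem2p10:
  shows "\<exists>A :: (nat \<Rightarrow> complex) normed_algebra.
    banach_algebra A \<and> stable A \<and> \<not> has_approximate_identity A"
  using banach_algebra_alg4 stable_alg4 no_approximate_identity_alg4 by blast

end
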